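(* Let $\gamma\in(0,1)$, and write $\mathrm{nc},\mathrm{sc},\mathrm{dc}$ for the functions $\mathrm{nc}(z;\gamma)=\frac{1}{\mathrm{cn}(z;\gamma)}$, $\mathrm{sc}(z;\gamma)=\frac{\mathrm{sn}(z;\gamma)}{\mathrm{cn}(z;\gamma)}$, $\mathrm{dc}(z;\gamma)=\frac{\mathrm{dn}(z;\gamma)}{\mathrm{cn}(z;\gamma)}$, where $\mathrm{sn},\mathrm{cn},\mathrm{dn}$ are the Jacobi elliptic functions of modulus $\gamma$. Then, with respect to the Lie bracket of meromorphic vector fields in one variable $z$: (1) $(J,P_1,P_2)=\left(\frac{i\,\mathrm{dc}}{\gamma}\frac{d}{dz},\ \frac{\mathrm{nc}}{\gamma}\frac{d}{dz},\ i\,\mathrm{sc}\frac{d}{dz}\right)$ satisfies the elliptic Cayley-Klein relations; (2) $(J,P_1,P_2)=\left(\frac{i\,\mathrm{dc}}{\gamma}\frac{d}{dz},\ -\mathrm{sc}\frac{d}{dz},\ -\frac{i\,\mathrm{nc}}{\gamma}\frac{d}{dz}\right)$ satisfies the hyperbolic Cayley-Klein relations; (3) $(J,P_1,P_2)=\left(\frac{\mathrm{dc}}{\gamma}\frac{d}{dz},\ \frac{\mathrm{nc}}{\gamma}\frac{d}{dz},\ \mathrm{sc}\frac{d}{dz}\right)$ satisfies the co-hyperbolic Cayley-Klein relations; (4) $(J,P_1,P_2)=\left(\frac{\mathrm{dc}}{\gamma}\frac{d}{dz},\ \frac{i\,\mathrm{nc}}{\gamma}\frac{d}{dz},\ i\,\mathrm{sc}\frac{d}{dz}\right)$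 satisfies the doubly hyperbolic Cayley-Klein relations.
   Context: For meromorphic functions $f,g$ of one complex variable $z$, the Lie bracket of vector fields is $\left[f\frac{d}{dz},g\frac{d}{dz}\right]=\left(f\frac{dg}{dz}-g\frac{df}{dz}\right)\frac{d}{dz}$. The normalized 2-D Cayley-Klein relations with non-vanishing curvatures for a triple $(J,P_1,P_2)$ are: - elliptic: $[J,P_1]=P_2$, $[J,P_2]=-P_1$, $[P_1,P_2]=J$; - hyperbolic (Lobachevski): $[J,P_1]=P_2$, $[J,P_2]=-P_1$, $[P_1,P_2]=-J$; - co-hyperbolic (anti-de Sitter): $[J,P_1]=P_2$, $[J,P_2]=P_1$, $[P_1,P_2]=J$; - doubly hyperbolic (de Sitter): $[J,P_1]=P_2$, $[J,P_2]=P_1$, $[P_1,P_2]=-J$. The Jacobi elliptic functions of modulus $k$ are the meromorphic functions on $\mathbb{C}$ determined by $\mathrm{sn}'=\mathrm{cn}\,\mathrm{dn}$, $\mathrm{cn}'=-\mathrm{sn}\,\mathrm{dn}$, $\mathrm{dn}'=-k^2\,\mathrm{sn}\,\mathrm{cn}$ with $\mathrm{sn}(0)=0$, $\mathrm{cn}(0)=\mathrm{dn}(0)=1$. *)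

theory Defs
  imports "HOL-Complex_Analysis.Complex_Analysis"
begin

text \<open>
  Meromorphic functions are represented by total functions, whose values at poles and at
  removable singularities carry no information. Equality of meromorphic functions on the plane
  is therefore equality off a closed discrete set, which for meromorphic functions is the same as
  equality at every point where both are analytic.
\<close>

definition mero_eq :: "(complex \<Rightarrow> complex) \<Rightarrow> (complex \<Rightarrow> complex) \<Rightarrow> bool"
    (infix \<open>\<cong>\<^sub>m\<close> 50)
  where "f \<cong>\<^sub>m g \<longleftrightarrow> (\<forall>\<^sub>\<approx>z. f z = g z)"

text \<open>
  Analyticity at the origin ties the initial values to the meromorphic functions themselves;
  without it the total functions could take arbitrary values at the single point \<open>0\<close>.
\<close>

definition jacobi_elliptic ::
    "complex \<Rightarrow> (complex \<Rightarrow> complex) \<Rightarrow> (complex \<Rightarrow> complex) \<Rightarrow> (complex \<Rightarrow> complex) \<Rightarrow> bool"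
  where "jacobi_elliptic k sn cn dn \<longleftrightarrow>
    sn meromorphic_on UNIV \<and> cn meromorphic_on UNIV \<and> dn meromorphic_on UNIV \<and>
    sn analytic_on {0} \<and> cn analytic_on {0} \<and> dn analytic_on {0} \<and>
    deriv sn \<cong>\<^sub>m (\<lambda>z. cn z * dn z) \<and>
    deriv cn \<cong>\<^sub>m (\<lambda>z. - sn z * dn z) \<and>
    deriv dn \<cong>\<^sub>m (\<lambda>z. - k\<^sup>2 * sn z * cn z) \<and>
    sn 0 = 0 \<and> cn 0 = 1 \<and> dn 0 = 1"

text \<open>A vector field \<open>f d/dz\<close> is represented by its coefficient \<open>f\<close>.\<close>

definition lie_bracket :: "(complex \<Rightarrow> complex) \<Rightarrow> (complex \<Rightarrow> complex) \<Rightarrow> complex \<Rightarrow> complex"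
  where "lie_bracket f g = (\<lambda>z. f z * deriv g z - g z * deriv f z)"

definition meromorphic_triple ::
    "(complex \<Rightarrow> complex) \<Rightarrow> (complex \<Rightarrow> complex) \<Rightarrow> (complex \<Rightarrow> complex) \<Rightarrow> bool"
  where "meromorphic_triple J P1 P2 \<longleftrightarrow>
    J meromorphic_on UNIV \<and> P1 meromorphic_on UNIV \<and> P2 meromorphic_on UNIV"

definition elliptic_CK ::
    "(complex \<Rightarrow> complex) \<Rightarrow> (complex \<Rightarrow> complex) \<Rightarrow> (complex \<Rightarrow> complex) \<Rightarrow> bool"
  where "elliptic_CK J P1 P2 \<longleftrightarrow> meromorphic_triple J P1 P2 \<and>
    lie_bracket J P1 \<cong>\<^sub>m P2 \<and>
    lie_bracket J P2 \<cong>\<^sub>m (\<lambda>z. - P1 z) \<and>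
    lie_bracket P1 P2 \<cong>\<^sub>m J"

definition hyperbolic_CK ::
    "(complex \<Rightarrow> complex) \<Rightarrow> (complex \<Rightarrow> complex) \<Rightarrow> (complex \<Rightarrow> complex) \<Rightarrow> bool"
  where "hyperbolic_CK J P1 P2 \<longleftrightarrow> meromorphic_triple J P1 P2 \<and>
    lie_bracket J P1 \<cong>\<^sub>m P2 \<and>
    lie_bracket J P2 \<cong>\<^sub>m (\<lambda>z. - P1 z) \<and>
    lie_bracket P1 P2 \<cong>\<^sub>m (\<lambda>z. - J z)"

definition cohyperbolic_CK ::
    "(complex \<Rightarrow> complex) \<Rightarrow> (complex \<Rightarrow> complex) \<Rightarrow> (complex \<Rightarrow> complex) \<Rightarrow> bool"
  where "cohyperbolic_CK J P1 P2 \<longleftrightarrow> meromorphic_triple J P1 P2 \<and>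
    lie_bracket J P1 \<cong>\<^sub>m P2 \<and>
    lie_bracket J P2 \<cong>\<^sub>m P1 \<and>
    lie_bracket P1 P2 \<cong>\<^sub>m J"

definition doubly_hyperbolic_CK ::
    "(complex \<Rightarrow> complex) \<Rightarrow> (complex \<Rightarrow> complex) \<Rightarrow> (complex \<Rightarrow> complex) \<Rightarrow> bool"
  where "doubly_hyperbolic_CK J P1 P2 \<longleftrightarrow> meromorphic_triple J P1 P2 \<and>
    lie_bracket J P1 \<cong>\<^sub>m P2 \<and>
    lie_bracket J P2 \<cong>\<^sub>m P1 \<and>
    lie_bracket P1 P2 \<cong>\<^sub>m (\<lambda>z. - J z)"

end

theory Submission
  imports Defs
begin

text \<open>
  The Pythagorean identities \<open>sn\<^sup>2 + cn\<^sup>2 = 1\<close> and \<open>dn\<^sup>2 + k\<^sup>2 sn\<^sup>2 = 1\<close> hold because the left-hand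
  sides have derivative zero off a sparse set, whose complement is connected. They turn the
  quotient rule into \<open>nc' = sn dn / cn\<^sup>2\<close>, \<open>sc' = dn / cn\<^sup>2\<close> and \<open>dc' = (1 - k\<^sup>2) sn / cn\<^sup>2\<close>, hence
  \<open>[dc, nc] = k\<^sup>2 sc\<close>, \<open>[dc, sc] = nc\<close> and \<open>[nc, sc] = dc\<close>. The four triples are rescalings of
  \<open>dc\<close>, \<open>nc\<close>, \<open>sc\<close> by constants, and the bracket is bilinear and antisymmetric.
\<close>

lemma analytic_at_imp_has_deriv:
  "f analytic_on {z} \<Longrightarrow> (f has_field_derivative deriv f z) (at z)"
  by (simp add: DERIV_deriv_iff_field_differentiable analytic_on_imp_differentiable_at)

text \<open>Removing a sparse set from the plane leaves an open connected set, on which a vanishing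
  derivative forces \<open>f\<close> to be constant. Continuity at \<open>a\<close> identifies the
  constant.\<close>

lemma cosparse_eq_value_if_deriv_zero:
  fixes f :: "complex \<Rightarrow> complex"
  assumes "isCont f a" and "\<forall>\<^sub>\<approx>z. (f has_field_derivative 0) (at z)"
  shows "\<forall>\<^sub>\<approx>z. f z = f a"
proof -
  define S where "S = {z. \<not> (f has_field_derivative 0) (at z)}"
  have S: "S sparse_in UNIV"
    using assms(2) by (simp add: eventually_cosparse S_def)
  have "f constant_on (UNIV - S)"
  proof (rule has_field_derivative_0_imp_constant_on)
    show "(f has_field_derivative 0) (at z)" if "z \<in> UNIV - S" for z
      using that by (simp add: S_def)
    show "connected (UNIV - S)" "open (UNIV - S)"
      using S by (auto intro!: sparse_imp_connected open_diff_sparse_pts)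
  qed
  then obtain c where c: "\<And>z. z \<notin> S \<Longrightarrow> f z = c"
    unfolding constant_on_def by blast
  have ev: "\<forall>\<^sub>\<approx>z. f z = c"
    using eventually_not_in_cosparse[OF S] by eventually_elim (rule c)
  \<comment> \<open>A limit ignores the value at \<open>a\<close>, and a small punctured disc around
    \<open>a\<close> misses the exceptional set; so \<open>a\<close> itself may be
    exceptional.\<close>
  have "f \<midarrow>a\<rightarrow> c"
    using ev by (intro tendsto_eventually) (auto simp: eventually_cosparse_open_eq)
  moreover have "f \<midarrow>a\<rightarrow> f a"
    using assms(1) by (rule isContD)
  ultimately have "f a = c"
    by (rule LIM_unique[symmetric])
  with ev show ?thesis
    by simp
qed

text \<open>An equation for \<open>deriv\<close> carries information only where the function is
  differentiable. Meromorphic functions are analytic off a sparse set, so there \<open>deriv\<close>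
  is a genuine derivative.\<close>

lemma jacobi_elliptic_has_derivs:
  assumes "jacobi_elliptic k sn cn dn"
  shows "\<forall>\<^sub>\<approx>z. (sn has_field_derivative cn z * dn z) (at z) \<and>
              (cn has_field_derivative - sn z * dn z) (at z) \<and>
              (dn has_field_derivative - k\<^sup>2 * sn z * cn z) (at z)"
proof -
  have mero: "sn meromorphic_on UNIV" "cn meromorphic_on UNIV" "dn meromorphic_on UNIV"
    and derivs: "\<forall>\<^sub>\<approx>z. deriv sn z = cn z * dn z" "\<forall>\<^sub>\<approx>z. deriv cn z = - sn z * dn z"
      "\<forall>\<^sub>\<approx>z. deriv dn z = - k\<^sup>2 * sn z * cn z"
    using assms by (auto simp: jacobi_elliptic_def mero_eq_def)
  show ?thesis
    using mero[THEN meromorphic_on_imp_analytic_cosparse] derivs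
    by eventually_elim (auto dest!: analytic_at_imp_has_deriv)
qed

text \<open>The derivative is \<open>2 sn cn dn - 2 cn sn dn = 0\<close>, and the value at the
  origin is 1.\<close>

lemma jacobi_elliptic_sn_cn_square:
  assumes "jacobi_elliptic k sn cn dn"
  shows "\<forall>\<^sub>\<approx>z. (sn z)\<^sup>2 + (cn z)\<^sup>2 = 1"
proof -
  have "isCont (\<lambda>z. (sn z)\<^sup>2 + (cn z)\<^sup>2) 0"
    using assms unfolding jacobi_elliptic_def
    by (intro continuous_intros analytic_at_imp_isCont) auto
  moreover have "\<forall>\<^sub>\<approx>z. ((\<lambda>z. (sn z)\<^sup>2 + (cn z)\<^sup>2) has_field_derivative 0) (at z)"
    using jacobi_elliptic_has_derivs[OF assms]
    by eventually_elim (auto intro!: derivative_eq_intros)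
  ultimately show ?thesis
    using cosparse_eq_value_if_deriv_zero assms by (fastforce simp: jacobi_elliptic_def)
qed

lemma jacobi_elliptic_dn_sn_square:
  assumes "jacobi_elliptic k sn cn dn"
  shows "\<forall>\<^sub>\<approx>z. (dn z)\<^sup>2 + k\<^sup>2 * (sn z)\<^sup>2 = 1"
proof -
  have "isCont (\<lambda>z. (dn z)\<^sup>2 + k\<^sup>2 * (sn z)\<^sup>2) 0"
    using assms unfolding jacobi_elliptic_def
    by (intro continuous_intros analytic_at_imp_isCont) auto
  moreover have "\<forall>\<^sub>\<approx>z. ((\<lambda>z. (dn z)\<^sup>2 + k\<^sup>2 * (sn z)\<^sup>2) has_field_derivative 0) (at z)"
    using jacobi_elliptic_has_derivs[OF assms]
    by eventually_elim (auto intro!: derivative_eq_intros)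
  ultimately show ?thesis
    using cosparse_eq_value_if_deriv_zero assms by (fastforce simp: jacobi_elliptic_def)
qed

text \<open>By the identity theorem, a meromorphic function either vanishes off a sparse set or
  avoids zero off a sparse set. Since \<open>cn\<close> tends to 1 at the origin, the first case is
  impossible.\<close>

lemma jacobi_elliptic_cn_nonzero:
  assumes "jacobi_elliptic k sn cn dn"
  shows "\<forall>\<^sub>\<approx>z. cn z \<noteq> 0"
proof -
  have cn: "cn meromorphic_on UNIV" "cn analytic_on {0}" "cn 0 = 1"
    using assms by (auto simp: jacobi_elliptic_def)
  have "\<not> (\<forall>\<^sub>\<approx>z. cn z = 0)"
  proof
    assume "\<forall>\<^sub>\<approx>z. cn z = 0"
    hence "cn \<midarrow>0\<rightarrow> 0"
      by (intro tendsto_eventually) (auto simp: eventually_cosparse_open_eq)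
    moreover have "cn \<midarrow>0\<rightarrow> 1"
      using isContD[OF analytic_at_imp_isCont[OF cn(2)]] cn(3) by simp
    ultimately show False
      using LIM_unique by fastforce
  qed
  thus ?thesis
    using meromorphic_imp_constant_or_avoid[OF cn(1), of 0] by auto
qed

lemma jacobi_elliptic_quotient_derivs:
  assumes "jacobi_elliptic k sn cn dn"
  shows "\<forall>\<^sub>\<approx>z. ((\<lambda>z. 1 / cn z) has_field_derivative sn z * dn z / (cn z)\<^sup>2) (at z) \<and>
              ((\<lambda>z. sn z / cn z) has_field_derivative dn z / (cn z)\<^sup>2) (at z) \<and>
              ((\<lambda>z. dn z / cn z) has_field_derivative (1 - k\<^sup>2) * sn z / (cn z)\<^sup>2) (at z)"
  using jacobi_elliptic_has_derivs[OF assms] jacobi_elliptic_cn_nonzero[OF assms]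
    jacobi_elliptic_sn_cn_square[OF assms] jacobi_elliptic_dn_sn_square[OF assms]
proof eventually_elim
  case (elim z)
  \<comment> \<open>These are the numerators that the quotient rule gives for \<open>sc\<close> and
    \<open>dc\<close>. The first needs only \<open>sn\<^sup>2 + cn\<^sup>2 = 1\<close>, the second
    both quadratic identities.\<close>
  have "cn z * dn z * cn z - sn z * (- sn z * dn z) = dn z"
       "- k\<^sup>2 * sn z * cn z * cn z - dn z * (- sn z * dn z) = (1 - k\<^sup>2) * sn z"
    using elim(3,4) by algebra+
  with elim(1,2) show ?case
    by (auto intro!: derivative_eq_intros simp: power2_eq_square)
qed

lemma cosparse_lie_bracket_scaled:
  assumes "\<forall>\<^sub>\<approx>z. (f has_field_derivative f' z) (at z) \<and> (g has_field_derivative g' z) (at z) \<and>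
                f z * g' z - g z * f' z = h z"
  shows "lie_bracket (\<lambda>z. a * f z) (\<lambda>z. b * g z) \<cong>\<^sub>m (\<lambda>z. a * b * h z)"
  unfolding mero_eq_def using assms
proof eventually_elim
  case (elim z)
  have "deriv (\<lambda>z. a * f z) z = a * f' z" "deriv (\<lambda>z. b * g z) z = b * g' z"
    using elim by (auto intro!: DERIV_imp_deriv DERIV_cmult)
  hence "lie_bracket (\<lambda>z. a * f z) (\<lambda>z. b * g z) z = a * b * (f z * g' z - g z * f' z)"
    by (simp add: lie_bracket_def algebra_simps)
  with elim show ?case
    by simp
qed

text \<open>The last bracket is the third with its arguments exchanged. It is recorded separately
  because in the hyperbolic triple the multiple of \<open>sc\<close> comes before the multiple of
  \<open>nc\<close>.\<close>

lemma jacobi_elliptic_brackets: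
  assumes "jacobi_elliptic k sn cn dn"
  shows "lie_bracket (\<lambda>z. a * (dn z / cn z)) (\<lambda>z. b * (1 / cn z)) \<cong>\<^sub>m
           (\<lambda>z. a * b * (k\<^sup>2 * (sn z / cn z)))" (is ?dn)
    and "lie_bracket (\<lambda>z. a * (dn z / cn z)) (\<lambda>z. b * (sn z / cn z)) \<cong>\<^sub>m
           (\<lambda>z. a * b * (1 / cn z))" (is ?ds)
    and "lie_bracket (\<lambda>z. a * (1 / cn z)) (\<lambda>z. b * (sn z / cn z)) \<cong>\<^sub>m
           (\<lambda>z. a * b * (dn z / cn z))" (is ?ns)
    and "lie_bracket (\<lambda>z. a * (sn z / cn z)) (\<lambda>z. b * (1 / cn z)) \<cong>\<^sub>m
           (\<lambda>z. a * b * - (dn z / cn z))" (is ?sn)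
proof -
  have ev: "\<forall>\<^sub>\<approx>z. cn z \<noteq> 0 \<and> (sn z)\<^sup>2 + (cn z)\<^sup>2 = 1 \<and> (dn z)\<^sup>2 + k\<^sup>2 * (sn z)\<^sup>2 = 1"
    by (intro eventually_conj jacobi_elliptic_cn_nonzero[OF assms]
        jacobi_elliptic_sn_cn_square[OF assms] jacobi_elliptic_dn_sn_square[OF assms])
  note ev = ev jacobi_elliptic_quotient_derivs[OF assms]
  \<comment> \<open>With \<open>s\<close>, \<open>c\<close>, \<open>d\<close> for the values of
    \<open>sn\<close>, \<open>cn\<close>, \<open>dn\<close> at a point, each bracket becomes an
    identity of rational expressions. Over the common denominator \<open>c ^ 3\<close>, the
    quadratic relations pull a factor \<open>c\<^sup>2\<close> out of every numerator.\<close>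
  have dn_eq: "d / c * (s * d / c\<^sup>2) - 1 / c * ((1 - k\<^sup>2) * s / c\<^sup>2) = k\<^sup>2 * (s / c)"
   and ds_eq: "d / c * (d / c\<^sup>2) - s / c * ((1 - k\<^sup>2) * s / c\<^sup>2) = 1 / c"
   and ns_eq: "1 / c * (d / c\<^sup>2) - s / c * (s * d / c\<^sup>2) = d / c"
    if "c \<noteq> 0" "s\<^sup>2 + c\<^sup>2 = 1" "d\<^sup>2 + k\<^sup>2 * s\<^sup>2 = 1" for s c d :: complex
  proof -
    have num: "s * d\<^sup>2 - (1 - k\<^sup>2) * s = k\<^sup>2 * s * c\<^sup>2" "d\<^sup>2 - (1 - k\<^sup>2) * s\<^sup>2 = c\<^sup>2"
      "d - s\<^sup>2 * d = d * c\<^sup>2"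
      using that(2,3) by algebra+
    have "d / c * (s * d / c\<^sup>2) - 1 / c * ((1 - k\<^sup>2) * s / c\<^sup>2) = (s * d\<^sup>2 - (1 - k\<^sup>2) * s) / c ^ 3"
      "d / c * (d / c\<^sup>2) - s / c * ((1 - k\<^sup>2) * s / c\<^sup>2) = (d\<^sup>2 - (1 - k\<^sup>2) * s\<^sup>2) / c ^ 3"
      "1 / c * (d / c\<^sup>2) - s / c * (s * d / c\<^sup>2) = (d - s\<^sup>2 * d) / c ^ 3"
      by (simp_all add: divide_inverse power2_eq_square power3_eq_cube algebra_simps)
    with that(1) show "d / c * (s * d / c\<^sup>2) - 1 / c * ((1 - k\<^sup>2) * s / c\<^sup>2) = k\<^sup>2 * (s / c)"
      "d / c * (d / c\<^sup>2) - s / c * ((1 - k\<^sup>2) * s / c\<^sup>2) = 1 / c"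
      "1 / c * (d / c\<^sup>2) - s / c * (s * d / c\<^sup>2) = d / c"
      unfolding num by (simp_all add: power2_eq_square power3_eq_cube)
  qed
  show ?dn
    by (rule cosparse_lie_bracket_scaled, use ev in eventually_elim) (blast intro: dn_eq)
  show ?ds
    by (rule cosparse_lie_bracket_scaled, use ev in eventually_elim) (blast intro: ds_eq)
  show ?ns
    by (rule cosparse_lie_bracket_scaled, use ev in eventually_elim) (blast intro: ns_eq)
  have sn_eq: "s / c * (s * d / c\<^sup>2) - 1 / c * (d / c\<^sup>2) = - (d / c)"
    if "c \<noteq> 0" "s\<^sup>2 + c\<^sup>2 = 1" "d\<^sup>2 + k\<^sup>2 * s\<^sup>2 = 1" for s c d :: complex
    using arg_cong[where f = uminus, OF ns_eq[OF that]] by simp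
  show ?sn
    by (rule cosparse_lie_bracket_scaled, use ev in eventually_elim) (blast intro: sn_eq)
qed

theorem mainTheorem3:
  fixes \<gamma> :: real and sn cn dn nc sc dc :: "complex \<Rightarrow> complex"
  assumes "0 < \<gamma>" and "\<gamma> < 1"
    and "jacobi_elliptic (of_real \<gamma>) sn cn dn"
    and "nc = (\<lambda>z. 1 / cn z)"
    and "sc = (\<lambda>z. sn z / cn z)"
    and "dc = (\<lambda>z. dn z / cn z)"
  shows
    "elliptic_CK (\<lambda>z. \<i> * dc z / of_real \<gamma>) (\<lambda>z. nc z / of_real \<gamma>) (\<lambda>z. \<i> * sc z) \<and>
     hyperbolic_CK (\<lambda>z. \<i> * dc z / of_real \<gamma>) (\<lambda>z. - sc z) (\<lambda>z. - (\<i> * nc z / of_real \<gamma>)) \<and>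
     cohyperbolic_CK (\<lambda>z. dc z / of_real \<gamma>) (\<lambda>z. nc z / of_real \<gamma>) sc \<and>
     doubly_hyperbolic_CK (\<lambda>z. dc z / of_real \<gamma>) (\<lambda>z. \<i> * nc z / of_real \<gamma>) (\<lambda>z. \<i> * sc z)"
proof -
  define k where "k = complex_of_real \<gamma>"
  have k: "k \<noteq> 0"
    using assms(1) by (simp add: k_def)
  have jac: "jacobi_elliptic k sn cn dn"
    using assms(3) by (simp add: k_def)
  have [meromorphic_intros]:
    "sn meromorphic_on UNIV" "cn meromorphic_on UNIV" "dn meromorphic_on UNIV"
    using jac by (auto simp: jacobi_elliptic_def)
  have mero: "nc meromorphic_on UNIV" "sc meromorphic_on UNIV" "dc meromorphic_on UNIV"
    unfolding assms(4-6) by (intro meromorphic_intros)+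
  \<comment> \<open>Leaving \<open>h\<close> free, subject to an equation, lets these facts match
    any right-hand side of a Cayley-Klein relation. What remains is a comparison of
    constants.\<close>
  have dc_nc: "lie_bracket (\<lambda>z. a * dc z) (\<lambda>z. b * nc z) \<cong>\<^sub>m h"
    if "\<And>z. h z = a * b * k\<^sup>2 * sc z" for a b h
    using jacobi_elliptic_brackets(1)[OF jac, of a b] that
    by (simp add: assms(4-6) mero_eq_def mult.assoc)
  have dc_sc: "lie_bracket (\<lambda>z. a * dc z) (\<lambda>z. b * sc z) \<cong>\<^sub>m h"
    if "\<And>z. h z = a * b * nc z" for a b h
    using jacobi_elliptic_brackets(2)[OF jac, of a b] that
    by (simp add: assms(4-6) mero_eq_def)
  have nc_sc: "lie_bracket (\<lambda>z. a * nc z) (\<lambda>z. b * sc z) \<cong>\<^sub>m h"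
    if "\<And>z. h z = a * b * dc z" for a b h
    using jacobi_elliptic_brackets(3)[OF jac, of a b] that
    by (simp add: assms(4-6) mero_eq_def)
  have sc_nc: "lie_bracket (\<lambda>z. a * sc z) (\<lambda>z. b * nc z) \<cong>\<^sub>m h"
    if "\<And>z. h z = - (a * b * dc z)" for a b h
    using jacobi_elliptic_brackets(4)[OF jac, of a b] that
    by (simp add: assms(4-6) mero_eq_def)
  note brackets = dc_nc dc_sc nc_sc sc_nc
  \<comment> \<open>The constants are \<open>(i/k) (1/k) k\<^sup>2 = i\<close>,
    \<open>(i/k) i = -1/k\<close> and \<open>(1/k) i = i/k\<close>.\<close>
  have "elliptic_CK (\<lambda>z. \<i> / k * dc z) (\<lambda>z. 1 / k * nc z) (\<lambda>z. \<i> * sc z)"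
    unfolding elliptic_CK_def meromorphic_triple_def
    by (intro conjI brackets meromorphic_intros mero) (use k in \<open>auto simp: power2_eq_square\<close>)
  \<comment> \<open>The factor \<open>- 1\<close> here, like the factor \<open>1\<close> in the next
    triple, puts the field into the scaled form that the bracket facts expect.\<close>
  moreover have "hyperbolic_CK (\<lambda>z. \<i> / k * dc z) (\<lambda>z. - 1 * sc z) (\<lambda>z. - \<i> / k * nc z)"
    unfolding hyperbolic_CK_def meromorphic_triple_def
    by (intro conjI brackets meromorphic_intros mero) (use k in \<open>auto simp: power2_eq_square\<close>)
  moreover have "cohyperbolic_CK (\<lambda>z. 1 / k * dc z) (\<lambda>z. 1 / k * nc z) (\<lambda>z. 1 * sc z)"
    unfolding cohyperbolic_CK_def meromorphic_triple_def
    by (intro conjI brackets meromorphic_intros mero) (use k in \<open>auto simp: power2_eq_square\<close>)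
  \<comment> \<open>Multiplying \<open>P1\<close> and \<open>P2\<close> of the co-hyperbolic triple
    by i preserves the two relations with \<open>J\<close>, which are linear in \<open>P1\<close>
    and \<open>P2\<close>, and reverses the sign of \<open>[P1, P2]\<close>.\<close>
  moreover have "doubly_hyperbolic_CK (\<lambda>z. 1 / k * dc z) (\<lambda>z. \<i> / k * nc z) (\<lambda>z. \<i> * sc z)"
    unfolding doubly_hyperbolic_CK_def meromorphic_triple_def
    by (intro conjI brackets meromorphic_intros mero) (use k in \<open>auto simp: power2_eq_square\<close>)
  ultimately show ?thesis
    unfolding k_def[symmetric] by simp
qed

end
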